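(* Let $n>2$ be an integer and $\omega=\exp(2\pi\mathrm{i}/n)$. Define polynomials $P_k^{(j)}$ ($1\le j\le n$, $k\in\mathbb{N}_0$) by $P_0^{(j)}(x)=x$ for all $1\le j\le n$ and $$P_{k+1}^{(j)}(x)=\sum_{r=1}^{n}\omega^{(j-1)(r-1)}\,x^{(r-1)n^k}\,P_k^{(r)}(x),\qquad 1\le j\le n,\ k\in\mathbb{N}_0.$$ Let $(\varepsilon_m)_{m\in\mathbb{N}}$ be the sequence with values in $\{\omega^j\mid 0\le j\le n-1\}$ determined by $P_k^{(1)}(x)=\sum_{m=1}^{n^k}\varepsilon_m x^m$ for all $k\in\mathbb{N}_0$. Then the weighted Dirac comb $\sum_{m\in\mathbb{N}}\varepsilon_m\delta_m$ has purely absolutely continuous diffraction.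
   Context: $\mathbb{N}=\{1,2,3,\dots\}$, $\mathbb{N}_0=\mathbb{N}\cup\{0\}$, and $\delta_m$ is the unit point mass at $m\in\mathbb{R}$. The sequence $(\varepsilon_m)$ is well defined because the terms of $P_{k+1}^{(1)}$ of degree at most $n^k$ coincide with those of $P_k^{(1)}$. Diffraction: for a bounded complex sequence $(\varepsilon_m)_{m\in\mathbb{N}}$ put $\mu_N=\sum_{m=1}^{N}\varepsilon_m\delta_m$ and $\widetilde{\mu_N}=\sum_{m=1}^{N}\overline{\varepsilon_m}\,\delta_{-m}$ (complex conjugation). An autocorrelation of the Dirac comb $\sum_{m\in\mathbb{N}}\varepsilon_m\delta_m$ is a vague accumulation point $\gamma$, as $N\to\infty$, of the measures $\frac1N\,\mu_N*\widetilde{\mu_N}$ on $\mathbb{R}$ (the autocorrelation, if the limit exists). The corresponding diffraction measure is the Fourier transform $\widehat{\gamma}$, a positive measure on $\mathbb{R}$; equivalently, it is the corresponding vague accumulation point of the measures $\frac1N\bigl|\sum_{m=1}^{N}\varepsilon_m e^{-2\pi\mathrm{i}mt}\bigr|^2\,dt$. The comb has purely absolutely continuous diffraction if $\widehat{\gamma}$ is absolutely continuous with respect to Lebesgue measure (for every such $\gamma$). *)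

theory Defs
  imports "HOL-Analysis.Analysis" "HOL-Computational_Algebra.Polynomial"
begin

definition root_of_unity :: "nat \<Rightarrow> complex" where
  "root_of_unity n = exp (2 * of_real pi * \<i> / of_nat n)"

primrec rs_poly :: "nat \<Rightarrow> nat \<Rightarrow> nat \<Rightarrow> complex poly" where
  "rs_poly n 0 j = monom 1 1"
| "rs_poly n (Suc k) j =
     (\<Sum>r=1..n. smult (root_of_unity n ^ ((j - 1) * (r - 1)))
                   (monom 1 ((r - 1) * n ^ k) * rs_poly n k r))"

text \<open>
  A complex Radon measure on the real line is a linear functional on the space of
  compactly supported continuous functions, bounded on the functions supported in any fixed
  compact set. Values of the functional outside that space carry no meaning and are unconstrained.
\<close>

type_synonym functional = "(real \<Rightarrow> complex) \<Rightarrow> complex"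

definition Cc :: "(real \<Rightarrow> complex) set" where
  "Cc = {f. continuous_on UNIV f \<and> compact (closure {x. f x \<noteq> 0})}"

definition radon_measures :: "functional set" where
  "radon_measures = {\<mu>.
     (\<forall>f\<in>Cc. \<forall>g\<in>Cc. \<mu> (\<lambda>x. f x + g x) = \<mu> f + \<mu> g) \<and>
     (\<forall>c. \<forall>f\<in>Cc. \<mu> (\<lambda>x. c * f x) = c * \<mu> f) \<and>
     (\<forall>K. compact K \<longrightarrow> (\<exists>C. \<forall>f\<in>Cc. (\<forall>x. x \<notin> K \<longrightarrow> f x = 0) \<longrightarrow>
        norm (\<mu> f) \<le> C * (SUP x. norm (f x))))}"

definition vague_topology :: "functional topology" where
  "vague_topology =
     topology_generated_by {{\<mu> \<in> radon_measures. \<mu> f \<in> U} | f U. f \<in> Cc \<and> open U}"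

definition vague_accumulation_point :: "(nat \<Rightarrow> functional) \<Rightarrow> functional \<Rightarrow> bool" where
  "vague_accumulation_point \<mu> \<gamma> \<longleftrightarrow> \<gamma> \<in> radon_measures \<and>
     (\<forall>U. openin vague_topology U \<and> \<gamma> \<in> U \<longrightarrow> (\<exists>\<^sub>F N in sequentially. \<mu> N \<in> U))"

definition dirac :: "real \<Rightarrow> functional" where
  "dirac a = (\<lambda>f. f a)"

definition partial_comb :: "(nat \<Rightarrow> complex) \<Rightarrow> nat \<Rightarrow> functional" where
  "partial_comb \<epsilon> N = (\<lambda>f. \<Sum>m=1..N. \<epsilon> m * dirac (real m) f)"

definition partial_comb_tilde :: "(nat \<Rightarrow> complex) \<Rightarrow> nat \<Rightarrow> functional" where
  "partial_comb_tilde \<epsilon> N = (\<lambda>f. \<Sum>m=1..N. cnj (\<epsilon> m) * dirac (- real m) f)"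

text \<open>The formula below is used only for measures of finite support.\<close>

definition convolve :: "functional \<Rightarrow> functional \<Rightarrow> functional" where
  "convolve \<mu> \<nu> = (\<lambda>f. \<mu> (\<lambda>x. \<nu> (\<lambda>y. f (x + y))))"

definition autocorrelation :: "(nat \<Rightarrow> complex) \<Rightarrow> functional \<Rightarrow> bool" where
  "autocorrelation \<epsilon> \<gamma> \<longleftrightarrow>
     vague_accumulation_point
       (\<lambda>N f. 1 / of_nat N * convolve (partial_comb \<epsilon> N) (partial_comb_tilde \<epsilon> N) f) \<gamma>"

definition inverse_fourier :: "(real \<Rightarrow> complex) \<Rightarrow> real \<Rightarrow> complex" where
  "inverse_fourier g t = (LINT x|lborel. g x * exp (2 * of_real pi * \<i> * of_real (x * t)))"

text \<open>The convolution of \<open>g\<close> with the reflected conjugate \<open>\<lambda>x. cnj (g (- x))\<close>.\<close>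

definition self_correlation :: "(real \<Rightarrow> complex) \<Rightarrow> real \<Rightarrow> complex" where
  "self_correlation g x = (LINT y|lborel. g y * cnj (g (- (x - y))))"

text \<open>
  The Fourier transform of a measure in the sense of Argabright and Gil de Lamadrid (and of Berg
  and Forst), for the case in which it is a positive measure \<open>\<nu>\<close>. It is unique if it exists.
  The sign convention makes the transform of a finite measure \<open>\<gamma>\<close> have the density
  \<open>t \<mapsto> \<integral> exp (-2 \<pi> \<i> x t) d\<gamma>(x)\<close>.
\<close>

definition has_fourier_transform :: "functional \<Rightarrow> real measure \<Rightarrow> bool" where
  "has_fourier_transform \<gamma> \<nu> \<longleftrightarrow>
     sets \<nu> = sets borel \<and>
     (\<forall>K. compact K \<longrightarrow> emeasure \<nu> K < \<infinity>) \<and>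
     (\<forall>g\<in>Cc. integrable \<nu> (\<lambda>t. (norm (inverse_fourier g t))\<^sup>2) \<and>
        \<gamma> (self_correlation g) = of_real (LINT t|\<nu>. (norm (inverse_fourier g t))\<^sup>2))"

text \<open>
  The existence of the transform is part of the claim, and the claim about its absolute continuity
  does not rely on its uniqueness.
\<close>

definition purely_absolutely_continuous_diffraction :: "(nat \<Rightarrow> complex) \<Rightarrow> bool" where
  "purely_absolutely_continuous_diffraction \<epsilon> \<longleftrightarrow>
     (\<forall>\<gamma>. autocorrelation \<epsilon> \<gamma> \<longrightarrow>
        (\<exists>\<nu>. has_fourier_transform \<gamma> \<nu>) \<and>
        (\<forall>\<nu>. has_fourier_transform \<gamma> \<nu> \<longrightarrow> absolutely_continuous lborel \<nu>))"

end

theory Submission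
  imports Defs "HOL-Probability.Characteristic_Functions"
begin

text \<open>
  The only autocorrelation is the unit mass at 0, so the diffraction measure is Lebesgue measure.

  Written with indices from 0, the sequence \<open>e m = \<epsilon> (m + 1)\<close> obeys
  \<open>e (n * m + a) = \<omega> ^ (a * m) * e m\<close> for every digit \<open>a < n\<close>
  (\<open>rs_sequence_lowest_digit\<close>): it is the product of \<open>\<omega> ^ (d * d')\<close> over all pairs \<open>d, d'\<close>
  of adjacent base \<open>n\<close> digits of its index. Splitting the sum of \<open>e (m + h) * cnj (e m)\<close> over
  \<open>m < n * N\<close> by the lowest digit of \<open>m\<close> expresses it through \<open>n\<close> correlations of length
  \<open>N\<close> and the lags \<open>(a + h) div n\<close>, in which the summands carry the additional factor
  \<open>\<omega> ^ (h * m)\<close>. These lags are smaller than \<open>h\<close>, except that the digit \<open>n - 1\<close> reproduces the lag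
  1, but only at the shorter length. For the lag 0 this factor alone remains, and its sums cancel over
  full periods. Hence every correlation with a lag \<open>h > 0\<close> is \<open>O(sqrt N)\<close>
  (\<open>norm_twisted_correlation_bound\<close>), and an autocorrelation sends
  every \<open>f\<close> in \<open>Cc\<close> to \<open>f 0\<close> (\<open>autocorrelation_eq_dirac\<close>).

  For such a functional a Fourier transform is a locally finite Borel measure \<open>\<nu>\<close> with
  \<open>\<integral> |inverse_fourier g|\<^sup>2 d\<nu> = \<integral> |g|\<^sup>2\<close> for all \<open>g\<close> in \<open>Cc\<close>. Lebesgue measure has this property
  by Plancherel's theorem (\<open>plancherel_Cc\<close>). Conversely, testing the property with modulated tent
  functions gives \<open>\<nu> {a..b} \<le> 24 * (b - a)\<close> (\<open>interval_measure_bound\<close>), and covering a null set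
  by short intervals shows that each such \<open>\<nu>\<close> is absolutely continuous
  (\<open>absolutely_continuous_if_interval_bound\<close>).
\<close>

section \<open>The lowest digit of the index\<close>

lemma root_of_unity_power_n: "n > 0 \<Longrightarrow> root_of_unity n ^ n = 1"
  by (simp add: root_of_unity_def flip: exp_of_nat_mult)

lemma norm_root_of_unity: "norm (root_of_unity n) = 1"
  by (simp add: root_of_unity_def norm_exp_eq_Re)

lemma root_of_unity_power_eq_1_iff:
  assumes "n > 0"
  shows "root_of_unity n ^ c = 1 \<longleftrightarrow> n dvd c"
proof -
  have "root_of_unity n ^ c = exp (2 * of_real pi * \<i> * of_nat c / of_nat n)"
    by (simp add: root_of_unity_def mult_ac flip: exp_of_nat_mult)
  then show ?thesis
    using complex_root_unity_eq_1[of n c] assms by (simp add: mult_ac)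
qed

lemma coeff_rs_poly_eq_0:
  assumes "i = 0 \<or> n ^ k < i"
  shows "coeff (rs_poly n k j) i = 0"
  using assms
proof (induction k arbitrary: i j)
  case 0
  then show ?case by auto
next
  case (Suc k)
  have "coeff (rs_poly n k r) (i - (r - 1) * n ^ k) = 0"
    if r: "r \<in> {1..n}" and le: "(r - 1) * n ^ k \<le> i" for r
  proof (rule Suc.IH)
    have "r * n ^ k \<le> n * n ^ k"
      using r by (intro mult_right_mono) auto
    moreover have "r * n ^ k = (r - 1) * n ^ k + n ^ k"
      using r by (cases r) auto
    ultimately show "i - (r - 1) * n ^ k = 0 \<or> n ^ k < i - (r - 1) * n ^ k"
      using Suc.prems by auto
  qed
  then show ?case
    by (auto simp: coeff_sum coeff_monom_mult intro!: sum.neutral)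
qed

text \<open>
  The blocks \<open>x ^ ((r - 1) * n ^ k) * rs_poly n k r\<close> have disjoint supports, so only
  \<open>r = a + 1\<close> contributes to the given coefficient. This is the recursion in the
  highest digit of the index.
\<close>

lemma coeff_rs_poly_Suc:
  assumes "a < n" "m < n ^ k"
  shows "coeff (rs_poly n (Suc k) j) (a * n ^ k + m + 1) =
    root_of_unity n ^ ((j - 1) * a) * coeff (rs_poly n k (a + 1)) (m + 1)"
proof -
  let ?q = "\<lambda>r. root_of_unity n ^ ((j - 1) * (r - 1)) *
     (if a * n ^ k + m + 1 < (r - 1) * n ^ k then 0
      else coeff (rs_poly n k r) (a * n ^ k + m + 1 - (r - 1) * n ^ k))"
  have zero: "?q r = 0" if r: "r \<in> {1..n}" "r \<noteq> a + 1" for r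
  proof (cases "r - 1 < a")
    case True
    then have "r * n ^ k \<le> a * n ^ k"
      using r by (intro mult_right_mono) auto
    moreover have "r * n ^ k = (r - 1) * n ^ k + n ^ k"
      using r by (cases r) auto
    ultimately show ?thesis
      by (simp add: coeff_rs_poly_eq_0)
  next
    case False
    then have "(a + 1) * n ^ k \<le> (r - 1) * n ^ k"
      using r by (intro mult_right_mono) auto
    then have "a * n ^ k + m + 1 \<le> (r - 1) * n ^ k"
      using assms(2) by simp
    then show ?thesis
      by (simp add: coeff_rs_poly_eq_0)
  qed
  have "coeff (rs_poly n (Suc k) j) (a * n ^ k + m + 1) = (\<Sum>r=1..n. ?q r)"
    unfolding rs_poly.simps coeff_sum coeff_smult coeff_monom_mult by (intro sum.cong refl) simp
  also have "\<dots> = (\<Sum>r\<in>{a + 1}. ?q r)"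
    using assms(1) zero by (intro sum.mono_neutral_right) auto
  finally show ?thesis
    by simp
qed

lemma coeff_rs_poly_1:
  assumes "a < n"
  shows "coeff (rs_poly n 1 j) (a + 1) = root_of_unity n ^ ((j - 1) * a)"
  using coeff_rs_poly_Suc[of a n 0 0 j] assms by simp

text \<open>
  The polynomials are built by adding highest digits, but shifts of the index act on the
  lowest one. A new highest digit contributes the same factor to both sides
  as long as it is not adjacent to the lowest digit, which is why the induction starts with two
  digits and then passes from \<open>m\<close> to its lower digits \<open>m'\<close>.
\<close>

lemma coeff_rs_poly_lowest_digit:
  assumes "a < n" "m < n ^ Suc k"
  shows "coeff (rs_poly n (Suc (Suc k)) j) (n * m + a + 1) =
    root_of_unity n ^ (a * m) * coeff (rs_poly n (Suc k) j) (m + 1)"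
  using assms
proof (induction k arbitrary: j m)
  case 0
  then have "m < n" by simp
  then show ?case
    using coeff_rs_poly_Suc[of m n a 1 j] coeff_rs_poly_1[of a n "m + 1"]
      coeff_rs_poly_1[of m n j] 0 by (simp add: mult_ac del: rs_poly.simps)
next
  case (Suc k)
  define b m' where "b = m div n ^ Suc k" and "m' = m mod n ^ Suc k"
  have m: "m = b * n ^ Suc k + m'"
    unfolding b_def m'_def by (rule div_mult_mod_eq[symmetric])
  have n: "n > 0" using Suc.prems by simp
  have m': "m' < n ^ Suc k"
    using n by (simp add: m'_def)
  have b: "b < n"
    using Suc.prems n by (simp add: b_def less_mult_imp_div_less)
  have "n * m' + a < n ^ Suc (Suc k)"
  proof -
    have "n * (m' + 1) \<le> n * n ^ Suc k"
      using m' by (intro mult_left_mono) auto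
    then show ?thesis using Suc.prems by simp
  qed
  from coeff_rs_poly_Suc[OF b this, of j]
  have "coeff (rs_poly n (Suc (Suc (Suc k))) j) (n * m + a + 1) =
      root_of_unity n ^ ((j - 1) * b) * coeff (rs_poly n (Suc (Suc k)) (b + 1)) (n * m' + a + 1)"
    by (simp add: m algebra_simps del: rs_poly.simps)
  also have "\<dots> = root_of_unity n ^ (a * m') * coeff (rs_poly n (Suc (Suc k)) j) (m + 1)"
    using coeff_rs_poly_Suc[OF b m', of j] Suc.IH[OF Suc.prems(1) m', of "b + 1"]
    by (simp add: m mult_ac del: rs_poly.simps)
  also have "root_of_unity n ^ (a * m') = root_of_unity n ^ (a * m)"
  proof -
    have "a * m = n * (a * b * n ^ k) + a * m'"
      by (simp add: m algebra_simps)
    then show ?thesis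
      using n by (simp add: power_add power_mult root_of_unity_power_n)
  qed
  finally show ?case .
qed

lemma rs_sequence_lowest_digit:
  assumes n: "n > 1" and P: "\<And>k. rs_poly n k 1 = (\<Sum>m=1..n^k. monom (\<epsilon> m) m)" and a: "a < n"
  shows "\<epsilon> (n * m + a + 1) = root_of_unity n ^ (a * m) * \<epsilon> (m + 1)"
proof -
  have coeff: "coeff (rs_poly n k 1) (i + 1) = \<epsilon> (i + 1)" if "i < n ^ k" for i k
    using that unfolding P using that by (simp add: coeff_sum)
  have "m < n ^ m" using n by (intro power_gt_expt) simp
  also have "n ^ m \<le> n ^ Suc m"
    using n by (intro power_increasing) auto
  finally have m: "m < n ^ Suc m" .
  have "n * (m + 1) \<le> n * n ^ Suc m"
    using m by (intro mult_left_mono) auto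
  then have "n * m + a < n ^ Suc (Suc m)"
    using a by simp
  then show ?thesis
    using coeff_rs_poly_lowest_digit[OF a m, of 1] coeff[OF m] coeff[of "n * m + a" "Suc (Suc m)"]
    by (simp del: rs_poly.simps)
qed

section \<open>Decay of correlations\<close>

text \<open>
  The twist \<open>c\<close> is present because splitting off the lowest digit creates it: a correlation with
  lag \<open>h\<close>, whatever its twist, decomposes into correlations with the twist \<open>h\<close>.
\<close>

definition twisted_correlation :: "nat \<Rightarrow> (nat \<Rightarrow> complex) \<Rightarrow> nat \<Rightarrow> nat \<Rightarrow> nat \<Rightarrow> complex" where
  "twisted_correlation n e c h N = (\<Sum>m<N. root_of_unity n ^ (c * m) * e (m + h) * cnj (e m))"

lemma norm_twisted_correlation_diff:
  assumes "\<And>m. norm (e m) = 1"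
  shows "norm (twisted_correlation n e c h (M + r)) \<le> norm (twisted_correlation n e c h M) + r"
proof -
  have "twisted_correlation n e c h (M + r) = twisted_correlation n e c h M +
     (\<Sum>m=M..<M + r. root_of_unity n ^ (c * m) * e (m + h) * cnj (e m))"
    unfolding twisted_correlation_def lessThan_atLeast0 by (subst sum.atLeastLessThan_concat) auto
  also have "norm \<dots> \<le> norm (twisted_correlation n e c h M) +
     (\<Sum>m=M..<M + r. norm (root_of_unity n ^ (c * m) * e (m + h) * cnj (e m)))"
    by (intro norm_triangle_le add_left_mono norm_sum)
  also have "(\<Sum>m=M..<M + r. norm (root_of_unity n ^ (c * m) * e (m + h) * cnj (e m))) = r"
    by (simp add: norm_mult norm_power norm_root_of_unity assms)
  finally show ?thesis .
qed

text \<open>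
  With \<open>i = n * m + a\<close> the index \<open>i + h\<close> has quotient \<open>m + (a + h) div n\<close> and last digit
  \<open>(a + h) mod n\<close>. The \<open>m\<close>-dependent phases of the two factors are \<open>\<omega> ^ ((a + h) * m)\<close> and the
  conjugate of \<open>\<omega> ^ (a * m)\<close>, whose product is the new twist \<open>\<omega> ^ (h * m)\<close>. The old twist
  \<open>\<omega> ^ (c * i)\<close> no longer depends on \<open>m\<close>, since \<open>\<omega> ^ n = 1\<close>.
\<close>

lemma twisted_correlation_mult:
  assumes n: "n > 0"
    and e: "\<And>a m. a < n \<Longrightarrow> e (n * m + a) = root_of_unity n ^ (a * m) * e m"
  shows "twisted_correlation n e c h (n * N) =
    (\<Sum>a<n. root_of_unity n ^ (c * a + (a + h) mod n * ((a + h) div n)) *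
       twisted_correlation n e h ((a + h) div n) N)"
proof -
  let ?w = "root_of_unity n"
  have per: "?w ^ (n * x) = 1" for x
    using n by (simp add: power_mult root_of_unity_power_n)
  have unit: "?w ^ x * cnj (?w ^ x) = 1" for x
    by (metis complex_norm_square norm_power norm_root_of_unity of_real_1 power_one)
  have summand: "?w ^ (c * (n * m + a)) * e (n * m + a + h) * cnj (e (n * m + a)) =
     ?w ^ (c * a + (a + h) mod n * ((a + h) div n)) *
     (?w ^ (h * m) * e (m + (a + h) div n) * cnj (e m))" if a: "a < n" for a m
  proof -
    define q s where "q = (a + h) div n" and "s = (a + h) mod n"
    have as: "a + h = n * q + s" and s: "s < n"
      using n by (simp_all add: q_def s_def)
    have 1: "e (n * m + a + h) = ?w ^ (s * (m + q)) * e (m + q)"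
    proof -
      have "n * m + a + h = n * (m + q) + s" using as by (simp add: algebra_simps)
      then show ?thesis using e[OF s] by simp
    qed
    have 2: "?w ^ (c * (n * m + a)) = ?w ^ (c * a)"
    proof -
      have "c * (n * m + a) = n * (c * m) + c * a" by (simp add: algebra_simps)
      then show ?thesis by (simp add: power_add per)
    qed
    have 3: "?w ^ (s * m) = ?w ^ (a * m) * ?w ^ (h * m)"
    proof -
      have "a * m + h * m = n * (q * m) + s * m"
        using as by (metis add_mult_distrib mult.assoc)
      then show ?thesis by (metis power_add per mult_1)
    qed
    have "?w ^ (c * (n * m + a)) * e (n * m + a + h) * cnj (e (n * m + a)) =
       ?w ^ (c * a) * (?w ^ (s * m) * ?w ^ (s * q) * e (m + q)) * (cnj (?w ^ (a * m)) * cnj (e m))"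
      unfolding 1 2 e[OF a] by (simp add: power_add add_mult_distrib2)
    also have "\<dots> = (?w ^ (a * m) * cnj (?w ^ (a * m))) *
       (?w ^ (c * a) * ?w ^ (s * q) * (?w ^ (h * m) * e (m + q) * cnj (e m)))"
      unfolding 3 by (simp only: mult_ac)
    also have "\<dots> = ?w ^ (c * a + s * q) * (?w ^ (h * m) * e (m + q) * cnj (e m))"
      by (simp add: unit power_add del: complex_cnj_power)
    finally show ?thesis by (simp add: q_def s_def)
  qed
  have "twisted_correlation n e c h (n * N) =
     (\<Sum>m<N. \<Sum>a<n. ?w ^ (c * (n * m + a)) * e (n * m + a + h) * cnj (e (n * m + a)))"
  proof -
    let ?f = "\<lambda>i. ?w ^ (c * i) * e (i + h) * cnj (e i)"
    have block: "sum ?f {m * n..<m * n + n} = (\<Sum>a<n. ?f (n * m + a))" for m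
      by (rule sum.reindex_bij_witness[of _ "\<lambda>a. n * m + a" "\<lambda>i. i - n * m"])
        (auto simp: mult.commute)
    have "sum ?f {..<n * N} = (\<Sum>m<N. sum ?f {m * n..<m * n + n})"
      by (simp add: sum.nat_group mult.commute)
    then show ?thesis unfolding twisted_correlation_def block .
  qed
  also have "\<dots> = (\<Sum>m<N. \<Sum>a<n. ?w ^ (c * a + (a + h) mod n * ((a + h) div n)) *
     (?w ^ (h * m) * e (m + (a + h) div n) * cnj (e m)))"
    by (intro sum.cong refl) (simp add: summand)
  also have "\<dots> = (\<Sum>a<n. ?w ^ (c * a + (a + h) mod n * ((a + h) div n)) *
       twisted_correlation n e h ((a + h) div n) N)"
    unfolding twisted_correlation_def sum_distrib_left by (rule sum.swap)
  finally show ?thesis .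
qed

lemma norm_twisted_correlation_le:
  assumes n: "n > 0" and e1: "\<And>m. norm (e m) = 1"
    and e: "\<And>a m. a < n \<Longrightarrow> e (n * m + a) = root_of_unity n ^ (a * m) * e m"
  shows "norm (twisted_correlation n e c h N) \<le>
    n + (\<Sum>a<n. norm (twisted_correlation n e h ((a + h) div n) (N div n)))"
proof -
  have "norm (twisted_correlation n e c h N) \<le>
     norm (twisted_correlation n e c h (n * (N div n))) + real (N mod n)"
    using norm_twisted_correlation_diff[of e n c h "n * (N div n)" "N mod n"] e1 by simp
  moreover have "norm (twisted_correlation n e c h (n * (N div n))) \<le>
     (\<Sum>a<n. norm (twisted_correlation n e h ((a + h) div n) (N div n)))"
    by (subst twisted_correlation_mult)
      (use n e in \<open>auto intro!: order_trans[OF norm_sum] simp: norm_mult norm_power norm_root_of_unity\<close>)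
  moreover have "N mod n \<le> n" using n by (simp add: less_imp_le)
  ultimately show ?thesis by linarith
qed

text \<open>
  At lag 0 the summands are the powers of \<open>\<omega> ^ c \<noteq> 1\<close>, which cancel over each period of length
  \<open>n\<close>.
\<close>

lemma norm_twisted_correlation_0:
  assumes n: "n > 0" and e1: "\<And>m. norm (e m) = 1" and c: "\<not> n dvd c"
  shows "norm (twisted_correlation n e c 0 N) \<le> n"
proof -
  let ?w = "root_of_unity n ^ c"
  have ee: "e m * cnj (e m) = 1" for m
    by (metis complex_norm_square e1 of_real_1 power_one)
  have *: "twisted_correlation n e c 0 M = (\<Sum>m<M. ?w ^ m)" for M
    by (simp add: twisted_correlation_def power_mult mult.assoc ee)
  have "?w \<noteq> 1"
    using root_of_unity_power_eq_1_iff[OF n] c by simp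
  moreover have "?w ^ (n * k) = 1" for k
    using n by (metis mult.commute power_mult power_one root_of_unity_power_n)
  ultimately have "twisted_correlation n e c 0 (n * (N div n)) = 0"
    by (simp add: * sum_gp_strict)
  then have "norm (twisted_correlation n e c 0 N) \<le> real (N mod n)"
    using norm_twisted_correlation_diff[of e n c 0 "n * (N div n)" "N mod n"] e1 by simp
  also have "\<dots> \<le> n" using n by (simp add: less_imp_le)
  finally show ?thesis .
qed

text \<open>
  Induction on the lag. For \<open>h > 1\<close> all lags \<open>(a + h) div n\<close> are smaller than \<open>h\<close>, and the
  lag 0 occurs only if \<open>h < n\<close>, where the twist \<open>h\<close> is nontrivial. For \<open>h = 1\<close> exactly one digit,
  \<open>a = n - 1\<close>, carries and reproduces the lag 1 at length \<open>N div n\<close>, so the sum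
  grows by a bounded amount whenever the length is multiplied by \<open>n\<close>. That growth is
  logarithmic; the weaker bound by \<open>sqrt N\<close> is of the same shape in all cases and
  suffices for averages.
\<close>

lemma norm_twisted_correlation_bound:
  assumes n: "n > 1" and e1: "\<And>m. norm (e m) = 1"
    and e: "\<And>a m. a < n \<Longrightarrow> e (n * m + a) = root_of_unity n ^ (a * m) * e m"
    and h: "h > 0"
  shows "\<exists>K. \<forall>c N. norm (twisted_correlation n e c h N) \<le> K * sqrt N"
  using h
proof (induction h rule: less_induct)
  case (less h)
  let ?T = "twisted_correlation n e"
  have n0: "n > 0" using n by simp
  have rec: "norm (?T c h N) \<le> n + (\<Sum>a<n. norm (?T h ((a + h) div n) (N div n)))" for c h N
    using norm_twisted_correlation_le[of n e c h N] n0 e1 e by simp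
  have T0: "?T c h 0 = 0" for c h by (simp add: twisted_correlation_def)
  have sq: "sqrt (real (N div n)) \<le> sqrt (real N)" for N
    using n by simp
  have one: "1 \<le> sqrt (real N)" if "N > 0" for N
    using that by simp
  have zero: "norm (?T h 0 N) \<le> n" if "h > 0" "h < n" for h N
    using that norm_twisted_correlation_0[OF n0 e1] by (meson dvd_imp_le not_le)
  show ?case
  proof (cases "h = 1")
    case True
    define L where "L = real n + real n * real n"
    have "L > 0" using n by (simp add: L_def add_pos_pos)
    have step: "norm (?T c 1 N) \<le> L + norm (?T 1 1 (N div n))" for c N
    proof -
      have split: "{..<n} = insert (n - 1) {..<n - 1}" using n by auto
      have "(\<Sum>a<n. norm (?T 1 ((a + 1) div n) (N div n))) =
          (\<Sum>a<n - 1. norm (?T 1 0 (N div n))) + norm (?T 1 1 (N div n))"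
        unfolding split by (subst sum.insert) (use n in \<open>auto intro!: sum.cong\<close>)
      also have "(\<Sum>a<n - 1. norm (?T 1 0 (N div n))) \<le> (\<Sum>a<n - 1. real n)"
        using zero[of 1 "N div n"] n by (intro sum_mono) auto
      also have "\<dots> \<le> real n * real n" by (simp add: mult_right_mono)
      finally show ?thesis using rec[of c 1 N] by (simp add: L_def)
    qed
    \<comment> \<open>Since \<open>sqrt (N / 2) \<le> 3 / 4 * sqrt N\<close>, the constant \<open>4 * L\<close> absorbs the increment \<open>L\<close>.\<close>
    have "norm (?T 1 1 N) \<le> 4 * L * sqrt N" for N
    proof (induction N rule: less_induct)
      case (less N)
      show ?case
      proof (cases "N = 0")
        case False
        have "norm (?T 1 1 N) \<le> L + norm (?T 1 1 (N div n))" by (rule step)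
        also have "\<dots> \<le> L * sqrt N + 4 * L * sqrt (N div n)"
          using less[of "N div n"] n False \<open>L > 0\<close> one[of N] by (intro add_mono) auto
        also have "sqrt (N div n) \<le> 3 / 4 * sqrt N"
        proof (rule real_le_lsqrt)
          have "real (N div n) \<le> real N / real n" by (rule of_nat_div_le_of_nat)
          also have "\<dots> \<le> real N / 2" using n by (intro divide_left_mono) auto
          also have "\<dots> \<le> (3 / 4 * sqrt N)\<^sup>2" by (simp add: power_mult_distrib power2_eq_square)
          finally show "real (N div n) \<le> (3 / 4 * sqrt N)\<^sup>2" .
        qed simp
        also have "L * sqrt N + 4 * L * (3 / 4 * sqrt N) = 4 * L * sqrt N" by simp
        finally show ?thesis using \<open>L > 0\<close> by simp
      qed (simp add: T0)
    qed
    note bound = this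
    show ?thesis
    proof (intro exI allI)
      fix c N
      show "norm (?T c h N) \<le> 5 * L * sqrt N"
      proof (cases "N = 0")
        case False
        have "norm (?T c 1 N) \<le> L + 4 * L * sqrt (N div n)"
          using step[of c N] bound[of "N div n"] by linarith
        also have "\<dots> \<le> L * sqrt N + 4 * L * sqrt N"
          using one[of N] sq[of N] \<open>L > 0\<close> False by (intro add_mono mult_left_mono) auto
        finally show ?thesis using True by simp
      qed (simp add: T0)
    qed
  next
    case False
    then have h: "h > 1" using less.prems by simp
    have "\<exists>K. \<forall>N. norm (?T h ((a + h) div n) N) \<le> K * sqrt N" if a: "a < n" for a
    proof (cases "(a + h) div n = 0")
      case True
      then have "h < n" using n by (simp add: div_eq_0_iff)
      have "norm (?T h 0 N) \<le> n * sqrt N" for N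
      proof (cases "N = 0")
        case False
        then have "real n \<le> n * sqrt N" using mult_left_mono[OF one[of N], of n] by simp
        then show ?thesis using zero[OF less.prems \<open>h < n\<close>, of N] by linarith
      qed (simp add: T0)
      then show ?thesis using True by auto
    next
      case False
      have "a + h < h * n"
      proof -
        have "(n - 1) * 1 < (n - 1) * h" using n h by (intro mult_strict_left_mono) auto
        then have "n - 1 + h < h * n" using n h by (simp add: algebra_simps)
        then show ?thesis using a by simp
      qed
      then have "(a + h) div n < h" by (simp add: less_mult_imp_div_less)
      then show ?thesis using less.IH False by blast
    qed
    then obtain K where K: "\<And>a N. a < n \<Longrightarrow> norm (?T h ((a + h) div n) N) \<le> K a * sqrt N"
      by metis
    show ?thesis
    proof (intro exI allI)
      fix c N
      show "norm (?T c h N) \<le> (n + (\<Sum>a<n. \<bar>K a\<bar>)) * sqrt N"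
      proof (cases "N = 0")
        case False
        have "norm (?T c h N) \<le> n + (\<Sum>a<n. norm (?T h ((a + h) div n) (N div n)))"
          by (rule rec)
        also have "\<dots> \<le> n * sqrt N + (\<Sum>a<n. \<bar>K a\<bar> * sqrt N)"
        proof (intro add_mono sum_mono)
          show "real n \<le> n * sqrt N" using mult_left_mono[OF one[of N], of n] False by simp
        next
          fix a assume "a \<in> {..<n}"
          then have "norm (?T h ((a + h) div n) (N div n)) \<le> K a * sqrt (N div n)"
            using K by simp
          also have "\<dots> \<le> \<bar>K a\<bar> * sqrt N" using sq[of N] by (intro mult_mono) auto
          finally show "norm (?T h ((a + h) div n) (N div n)) \<le> \<bar>K a\<bar> * sqrt N" .
        qed
        finally show ?thesis by (simp add: algebra_simps sum_distrib_left)
      qed (simp add: T0)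
    qed
  qed
qed

section \<open>The autocorrelation is a point mass\<close>

lemma Cc_E:
  assumes "g \<in> Cc"
  obtains M B where "M > 0" "B > 0" "\<And>x. \<bar>x\<bar> > M \<Longrightarrow> g x = 0" "\<And>x. norm (g x) \<le> B"
proof -
  have cont: "continuous_on UNIV g" and comp: "compact (closure {x. g x \<noteq> 0})"
    using assms by (auto simp: Cc_def)
  obtain M where M: "M > 0" "\<And>x. x \<in> closure {x. g x \<noteq> 0} \<Longrightarrow> norm x \<le> M"
    using compact_imp_bounded[OF comp] by (auto simp: bounded_pos)
  have zero: "g x = 0" if "\<bar>x\<bar> > M" for x
    using M(2)[of x] closure_subset[of "{x. g x \<noteq> 0}"] that by auto
  have "bounded (g ` {-M..M})"
    by (intro compact_imp_bounded compact_continuous_image continuous_on_subset[OF cont]) auto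
  then obtain B where B: "B > 0" "\<And>x. x \<in> {-M..M} \<Longrightarrow> norm (g x) \<le> B"
    by (auto simp: bounded_pos)
  have "norm (g x) \<le> B" for x
    using B(1) B(2)[of x] zero[of x] by (cases "\<bar>x\<bar> > M") (auto simp: abs_le_iff not_less)
  then show ?thesis using that M(1) B(1) zero by blast
qed

lemma Cc_I:
  assumes "continuous_on UNIV g" "\<And>x. \<bar>x\<bar> > M \<Longrightarrow> g x = 0"
  shows "g \<in> Cc"
proof -
  have "{x. g x \<noteq> 0} \<subseteq> cball 0 M"
    using assms(2) by (force simp: not_less[symmetric])
  then have "bounded (closure {x. g x \<noteq> 0})"
    by (meson bounded_cball bounded_closure bounded_subset)
  then show ?thesis
    using assms(1) by (simp add: Cc_def compact_eq_bounded_closed)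
qed

text \<open>
  Evaluation at \<open>f\<close> is vaguely continuous, so disjoint neighbourhoods of \<open>\<gamma> f\<close> and \<open>L\<close> would keep the
  functionals \<open>\<mu> N\<close> eventually away from \<open>\<gamma>\<close>.
\<close>

lemma vague_accumulation_point_eq_limit:
  assumes acc: "vague_accumulation_point \<mu> \<gamma>" and f: "f \<in> Cc" and lim: "(\<lambda>N. \<mu> N f) \<longlonglongrightarrow> L"
  shows "\<gamma> f = L"
proof (rule ccontr)
  assume "\<gamma> f \<noteq> L"
  then obtain U V where UV: "open U" "open V" "\<gamma> f \<in> U" "L \<in> V" "U \<inter> V = {}"
    by (meson hausdorff)
  let ?S = "{\<mu> \<in> radon_measures. \<mu> f \<in> U}"
  have "openin vague_topology ?S"
    unfolding vague_topology_def by (rule topology_generated_by_Basis) (use f UV in blast)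
  then have "\<exists>\<^sub>F N in sequentially. \<mu> N \<in> ?S"
    using acc UV(3) unfolding vague_accumulation_point_def by blast
  moreover have "\<forall>\<^sub>F N in sequentially. \<mu> N f \<in> V"
    using lim UV by (auto simp: tendsto_def)
  then have "\<forall>\<^sub>F N in sequentially. \<mu> N \<in> ?S \<longrightarrow> \<mu> N \<in> ?S \<and> \<mu> N f \<in> V"
    by (rule eventually_mono) simp
  ultimately have "\<exists>\<^sub>F N in sequentially. \<mu> N \<in> ?S \<and> \<mu> N f \<in> V"
    by (rule frequently_rev_mp)
  then show False
    using UV(5) by (auto dest: frequently_ex)
qed

text \<open>The weight at \<open>h\<close> of the finite measure \<open>\<mu>\<^sub>N * \<mu>\<^sub>N~\<close>.\<close>

definition lag_sum :: "(nat \<Rightarrow> complex) \<Rightarrow> nat \<Rightarrow> int \<Rightarrow> complex" where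
  "lag_sum \<epsilon> N h = (\<Sum>(m, l) \<in> {p \<in> {1..N} \<times> {1..N}. int (fst p) - int (snd p) = h}. \<epsilon> m * cnj (\<epsilon> l))"

lemma convolve_partial_comb:
  assumes f: "\<And>x. \<bar>x\<bar> > real M \<Longrightarrow> f x = 0"
  shows "convolve (partial_comb \<epsilon> N) (partial_comb_tilde \<epsilon> N) f =
    (\<Sum>h=-int M..int M. f (of_int h) * lag_sum \<epsilon> N h)"
proof -
  define F where "F = (\<lambda>(m, l). \<epsilon> m * cnj (\<epsilon> l) * f (real m - real l))"
  define d where "d = (\<lambda>p :: nat \<times> nat. int (fst p) - int (snd p))"
  let ?A = "{1..N} \<times> {1..N}" and ?H = "{-int M..int M}"
  have "convolve (partial_comb \<epsilon> N) (partial_comb_tilde \<epsilon> N) f =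
    (\<Sum>m=1..N. \<Sum>l=1..N. F (m, l))"
    by (simp add: convolve_def partial_comb_def partial_comb_tilde_def dirac_def F_def
        sum_distrib_left mult.assoc)
  also have "\<dots> = sum F ?A"
    by (simp add: sum.cartesian_product)
  also have "\<dots> = sum F {p \<in> ?A. d p \<in> ?H}"
  proof (rule sum.mono_neutral_right)
    show "\<forall>p \<in> ?A - {p \<in> ?A. d p \<in> ?H}. F p = 0"
    proof
      fix p assume p: "p \<in> ?A - {p \<in> ?A. d p \<in> ?H}"
      obtain m l where ml: "p = (m, l)" by (cases p)
      have "\<bar>int m - int l\<bar> > int M" using p ml by (auto simp: d_def)
      then have "\<bar>real m - real l\<bar> > real M" by linarith
      then show "F p = 0" by (simp add: F_def ml f)
    qed
  qed auto
  also have "\<dots> = (\<Sum>h\<in>?H. sum F {p \<in> {p \<in> ?A. d p \<in> ?H}. d p = h})"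
    by (rule sum.group[symmetric]) auto
  also have "\<dots> = (\<Sum>h\<in>?H. f (of_int h) * lag_sum \<epsilon> N h)"
  proof (rule sum.cong[OF refl])
    fix h assume h: "h \<in> ?H"
    have eq: "{p \<in> {p \<in> ?A. d p \<in> ?H}. d p = h} = {p \<in> ?A. int (fst p) - int (snd p) = h}"
      using h by (auto simp: d_def)
    have "F p = f (of_int h) * (case p of (m, l) \<Rightarrow> \<epsilon> m * cnj (\<epsilon> l))"
      if "int (fst p) - int (snd p) = h" for p
      using that by (cases p) (auto simp: F_def)
    then show "sum F {p \<in> {p \<in> ?A. d p \<in> ?H}. d p = h} = f (of_int h) * lag_sum \<epsilon> N h"
      unfolding eq lag_sum_def sum_distrib_left by (intro sum.cong) auto
  qed
  finally show ?thesis .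
qed

lemma lag_sum_uminus: "lag_sum \<epsilon> N (- h) = cnj (lag_sum \<epsilon> N h)"
  unfolding lag_sum_def cnj_sum
  by (rule sum.reindex_bij_witness[of _ prod.swap prod.swap]) (auto simp: mult.commute)

lemma lag_sum_0:
  assumes "\<And>m. m \<ge> 1 \<Longrightarrow> norm (\<epsilon> m) = 1"
  shows "lag_sum \<epsilon> N 0 = of_nat N"
proof -
  have "lag_sum \<epsilon> N 0 = (\<Sum>m=1..N. \<epsilon> m * cnj (\<epsilon> m))"
    unfolding lag_sum_def
    by (rule sum.reindex_bij_witness[of _ "\<lambda>m. (m, m)" fst]) auto
  also have "\<dots> = (\<Sum>m=1..N. 1)"
    by (intro sum.cong refl) (metis atLeastAtMost_iff assms complex_norm_square of_real_1 power_one)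
  finally show ?thesis by simp
qed

lemma lag_sum_eq_twisted_correlation:
  "lag_sum \<epsilon> N (int h) = twisted_correlation n (\<lambda>m. \<epsilon> (m + 1)) 0 h (N - h)"
proof -
  have *: "int a - int b = int h \<longleftrightarrow> a = b + h" for a b
    by linarith
  then show ?thesis
    unfolding lag_sum_def twisted_correlation_def *
    by (intro sum.reindex_bij_witness[of _ "\<lambda>l. (l + h + 1, l + 1)" "\<lambda>p. snd p - 1"])
      (auto simp: add_ac)
qed

lemma lag_average_tendsto_0:
  assumes n: "n > 1" and e1: "\<And>m. m \<ge> 1 \<Longrightarrow> norm (\<epsilon> m) = 1"
    and e: "\<And>a m. a < n \<Longrightarrow> \<epsilon> (n * m + a + 1) = root_of_unity n ^ (a * m) * \<epsilon> (m + 1)"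
    and h: "h \<noteq> 0"
  shows "(\<lambda>N. lag_sum \<epsilon> N h / of_nat N) \<longlonglongrightarrow> 0"
proof -
  have pos: "(\<lambda>N. lag_sum \<epsilon> N (int k) / of_nat N) \<longlonglongrightarrow> 0" if k: "k > 0" for k
  proof -
    obtain K where K: "\<And>c N. norm (twisted_correlation n (\<lambda>m. \<epsilon> (m + 1)) c k N) \<le> K * sqrt N"
      using norm_twisted_correlation_bound[of n "\<lambda>m. \<epsilon> (m + 1)" k] n e1 e k by auto
    have "norm (lag_sum \<epsilon> N (int k) / of_nat N) \<le> \<bar>K\<bar> / sqrt N" for N
    proof -
      have "norm (lag_sum \<epsilon> N (int k)) \<le> K * sqrt (real (N - k))"
        using K by (simp add: lag_sum_eq_twisted_correlation[of _ _ _ n])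
      also have "\<dots> \<le> \<bar>K\<bar> * sqrt N" by (intro mult_mono) auto
      finally have "norm (lag_sum \<epsilon> N (int k)) / N \<le> \<bar>K\<bar> * sqrt N / N"
        by (rule divide_right_mono) simp
      also have "\<bar>K\<bar> * sqrt N / N = \<bar>K\<bar> / sqrt N"
        by (cases "N = 0") (simp_all add: field_simps)
      finally show ?thesis by (simp add: norm_divide)
    qed
    then have "\<forall>\<^sub>F N in sequentially. norm (lag_sum \<epsilon> N (int k) / of_nat N) \<le> \<bar>K\<bar> / sqrt N"
      by (intro always_eventually allI)
    moreover have "(\<lambda>N. \<bar>K\<bar> / sqrt (real N)) \<longlonglongrightarrow> 0"
      by real_asymp
    ultimately show ?thesis
      by (rule Lim_null_comparison)
  qed
  show ?thesis
  proof (cases "h > 0")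
    case True
    then show ?thesis using pos[of "nat h"] by simp
  next
    case False
    then have "(\<lambda>N. cnj (lag_sum \<epsilon> N (- h) / of_nat N)) \<longlonglongrightarrow> cnj 0"
      using pos[of "nat (- h)"] h by (intro tendsto_cnj) simp
    then show ?thesis by (simp add: lag_sum_uminus)
  qed
qed

lemma autocorrelation_eq_dirac:
  assumes n: "n > 1" and e1: "\<And>m. m \<ge> 1 \<Longrightarrow> norm (\<epsilon> m) = 1"
    and e: "\<And>a m. a < n \<Longrightarrow> \<epsilon> (n * m + a + 1) = root_of_unity n ^ (a * m) * \<epsilon> (m + 1)"
    and acc: "autocorrelation \<epsilon> \<gamma>" and f: "f \<in> Cc"
  shows "\<gamma> f = f 0"
proof (rule vague_accumulation_point_eq_limit[OF acc[unfolded autocorrelation_def] f])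
  obtain R where R: "\<And>x. \<bar>x\<bar> > R \<Longrightarrow> f x = 0"
    using Cc_E[OF f] by metis
  define M where "M = nat \<lceil>R\<rceil>"
  have M: "f x = 0" if "\<bar>x\<bar> > real M" for x
    using that R[of x] unfolding M_def by linarith
  have "(\<lambda>N. \<Sum>h=-int M..int M. f (of_int h) * (lag_sum \<epsilon> N h / of_nat N)) \<longlonglongrightarrow>
      (\<Sum>h=-int M..int M. f (of_int h) * of_bool (h = 0))"
  proof (intro tendsto_sum tendsto_mult tendsto_const)
    fix h :: int
    show "(\<lambda>N. lag_sum \<epsilon> N h / of_nat N) \<longlonglongrightarrow> of_bool (h = 0)"
    proof (cases "h = 0")
      case True
      have "\<forall>\<^sub>F N in sequentially. lag_sum \<epsilon> N h / of_nat N = 1"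
        using eventually_gt_at_top[of 0] by eventually_elim (simp add: True lag_sum_0[OF e1])
      then show ?thesis using True by (simp add: tendsto_eventually)
    next
      case False
      then show ?thesis using lag_average_tendsto_0[OF n e1 e] by simp
    qed
  qed
  also have "(\<Sum>h=-int M..int M. f (of_int h) * of_bool (h = 0)) = (\<Sum>h\<in>{0}. f (of_int h))"
    by (rule sum.mono_neutral_cong_right) auto
  finally show "(\<lambda>N. 1 / of_nat N * convolve (partial_comb \<epsilon> N) (partial_comb_tilde \<epsilon> N) f) \<longlonglongrightarrow> f 0"
    by (simp add: convolve_partial_comb[OF M] sum_divide_distrib)
qed

section \<open>Plancherel's theorem for continuous functions of compact support\<close>

lemma borel_measurable_cnj [measurable]: "cnj \<in> borel_measurable borel"
  by (intro borel_measurable_continuous_onI continuous_intros)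

lemma integrable_bounded_support:
  fixes g :: "real \<Rightarrow> 'b::{banach, second_countable_topology}"
  assumes "g \<in> borel_measurable borel" "\<And>x. \<bar>x\<bar> > M \<Longrightarrow> g x = 0" "\<And>x. norm (g x) \<le> B"
  shows "integrable lborel g"
proof (rule Bochner_Integration.integrable_bound)
  show "integrable lborel (\<lambda>x. B * indicator {-M..M} x :: real)"
    by (intro integrable_mult_right integrable_real_indicator) (auto simp: emeasure_lborel_Icc_eq)
  show "AE x in lborel. norm (g x) \<le> norm (B * indicator {-M..M} x :: real)"
  proof (intro AE_I2)
    fix x
    show "norm (g x) \<le> norm (B * indicator {-M..M} x :: real)"
      using assms(2)[of x] assms(3)[of x] norm_ge_zero[of "g x"]
      by (cases "\<bar>x\<bar> > M") (auto simp: abs_le_iff not_less indicator_def split: if_splits)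
  qed
qed (use assms in simp)

lemma Cc_measurable: "g \<in> Cc \<Longrightarrow> g \<in> borel_measurable borel"
  by (simp add: Cc_def borel_measurable_continuous_onI)

lemma Cc_integrable:
  assumes "g \<in> Cc"
  shows "integrable lborel g"
  using Cc_E[OF assms] integrable_bounded_support[OF Cc_measurable[OF assms]] by metis

lemma self_correlation_in_Cc:
  assumes g: "g \<in> Cc"
  shows "self_correlation g \<in> Cc"
proof -
  obtain M B where M: "M > 0" "B > 0" "\<And>x. \<bar>x\<bar> > M \<Longrightarrow> g x = 0" "\<And>x. norm (g x) \<le> B"
    using Cc_E[OF g] by metis
  have cont: "continuous_on UNIV g" using g by (simp add: Cc_def)
  note [measurable] = Cc_measurable[OF g]
  have "continuous_on UNIV (self_correlation g)"
  proof (rule continuous_on_sequentiallyI)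
    fix u :: "nat \<Rightarrow> real" and a assume u: "u \<longlonglongrightarrow> a"
    show "(\<lambda>n. self_correlation g (u n)) \<longlonglongrightarrow> self_correlation g a"
      unfolding self_correlation_def
    proof (rule integral_dominated_convergence[where w = "\<lambda>y. norm (g y) * B"])
      show "integrable lborel (\<lambda>y. norm (g y) * B)"
        using Cc_integrable[OF g] by simp
      show "AE y in lborel. (\<lambda>n. g y * cnj (g (- (u n - y)))) \<longlonglongrightarrow> g y * cnj (g (- (a - y)))"
        by (intro AE_I2 tendsto_intros continuous_on_tendsto_compose[OF cont] u) auto
      show "AE y in lborel. norm (g y * cnj (g (- (u n - y)))) \<le> norm (g y) * B" for n
        by (intro AE_I2) (simp add: norm_mult M mult_left_mono)
    qed measurable
  qed
  moreover have "self_correlation g x = 0" if x: "\<bar>x\<bar> > 2 * M" for x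
  proof -
    have vanish: "g y * cnj (g (- (x - y))) = 0" for y
    proof (cases "\<bar>y\<bar> > M")
      case False
      then have "\<bar>- (x - y)\<bar> > M" using x by linarith
      then show ?thesis using M(3) by simp
    qed (use M(3) in simp)
    show ?thesis unfolding self_correlation_def vanish by simp
  qed
  ultimately show ?thesis by (rule Cc_I)
qed

lemma self_correlation_0:
  "self_correlation g 0 = of_real (LINT x|lborel. (norm (g x))\<^sup>2)"
proof -
  have "self_correlation g 0 = (LINT x|lborel. complex_of_real ((norm (g x))\<^sup>2))"
    unfolding self_correlation_def
    by (simp only: complex_norm_square) simp
  also have "\<dots> = of_real (LINT x|lborel. (norm (g x))\<^sup>2)"
    by (rule integral_complex_of_real)
  finally show ?thesis .
qed

text \<open>
  The convolution theorem: after Fubini the substitution of \<open>y - x\<close> for \<open>x\<close> turns the inner integral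
  into a multiple of the conjugate transform.
\<close>

lemma inverse_fourier_self_correlation:
  assumes g: "g \<in> Cc"
  shows "inverse_fourier (self_correlation g) t = of_real ((norm (inverse_fourier g t))\<^sup>2)"
proof -
  define E where "E x = exp (2 * of_real pi * \<i> * of_real (x * t))" for x :: real
  obtain M B where M: "M > 0" "B > 0" "\<And>x. \<bar>x\<bar> > M \<Longrightarrow> g x = 0" "\<And>x. norm (g x) \<le> B"
    using Cc_E[OF g] by metis
  note [measurable] = Cc_measurable[OF g]
  have [measurable]: "E \<in> borel_measurable borel"
    unfolding E_def by measurable
  have E: "E (x + y) = E x * E y" "norm (E x) = 1" "cnj (E x) = E (- x)" for x y
    by (simp_all add: E_def distrib_left distrib_right exp_add norm_exp_eq_Re exp_cnj)
  define F where "F x y = g y * cnj (g (y - x)) * E x" for x y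
  have int: "integrable (lborel \<Otimes>\<^sub>M lborel) (\<lambda>(x, y). F x y)"
  proof (rule Bochner_Integration.integrable_bound)
    show "integrable (lborel \<Otimes>\<^sub>M lborel) (\<lambda>z :: real \<times> real.
        B * B * indicator ({-2*M..2*M} \<times> {-M..M}) z :: real)"
      by (intro integrable_mult_right integrable_real_indicator)
        (auto simp: emeasure_lborel_Icc_eq lborel.emeasure_pair_measure_Times ennreal_mult_less_top)
    show "AE z in lborel \<Otimes>\<^sub>M lborel. norm (case z of (x, y) \<Rightarrow> F x y) \<le>
        norm (B * B * indicator ({-2*M..2*M} \<times> {-M..M}) z :: real)"
    proof (intro AE_I2)
      fix z :: "real \<times> real"
      obtain x y where z: "z = (x, y)" by (cases z)
      have "norm (F x y) \<le> B * B"
        using M by (simp add: F_def norm_mult E mult_mono)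
      moreover have "F x y = 0" if "(x, y) \<notin> {-2*M..2*M} \<times> {-M..M}"
      proof (cases "\<bar>y\<bar> > M")
        case False
        then have "\<bar>y - x\<bar> > M" using that by (auto simp: abs_le_iff not_less)
        then show ?thesis using M(3) by (simp add: F_def)
      qed (use M(3) in \<open>simp add: F_def\<close>)
      ultimately show "norm (case z of (x, y) \<Rightarrow> F x y) \<le>
          norm (B * B * indicator ({-2*M..2*M} \<times> {-M..M}) z :: real)"
        using M by (cases "(x, y) \<in> {-2*M..2*M} \<times> {-M..M}") (auto simp: z)
    qed
  qed (simp add: F_def split_beta')
  have inner: "(LINT x|lborel. F x y) = g y * E y * cnj (inverse_fourier g t)" for y
  proof -
    have "(LINT x|lborel. F x y) = (LINT x|lborel. F (y - x) y)"
      using lborel_integral_real_affine[of "-1" "\<lambda>x. F x y" y] by simp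
    also have "\<dots> = (LINT x|lborel. g y * E y * cnj (g x * E x))"
      using E(1)[of y "- x" for x]
      by (intro Bochner_Integration.integral_cong refl) (simp add: F_def E(3) mult_ac)
    also have "\<dots> = g y * E y * (LINT x|lborel. cnj (g x * E x))"
      by (rule integral_mult_right_zero)
    also have "(LINT x|lborel. cnj (g x * E x)) = cnj (inverse_fourier g t)"
      unfolding inverse_fourier_def E_def[symmetric] by (rule Bochner_Integration.integral_cnj)
    finally show ?thesis .
  qed
  have "inverse_fourier (self_correlation g) t = (LINT x|lborel. LINT y|lborel. F x y)"
    unfolding inverse_fourier_def self_correlation_def F_def E_def[symmetric] by simp
  also have "\<dots> = (LINT y|lborel. LINT x|lborel. F x y)"
    by (rule lborel_pair.Fubini_integral[OF int, symmetric])
  also have "\<dots> = inverse_fourier g t * cnj (inverse_fourier g t)"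
    unfolding inner by (simp add: inverse_fourier_def E_def)
  finally show ?thesis by (simp only: complex_norm_square)
qed

lemma char_std_normal_distribution_LINT:
  "(LINT x|lborel. of_real (std_normal_density x) * exp (\<i> * of_real (t * x))) =
    complex_of_real (exp (- t\<^sup>2 / 2))"
proof -
  have "char std_normal_distribution t = (LINT x|lborel. std_normal_density x *\<^sub>R iexp (t * x))"
    unfolding char_def by (subst integral_density) auto
  then show ?thesis
    by (simp add: char_std_normal_distribution scaleR_conv_of_real)
qed

text \<open>
  Fubini's theorem and the fact that a Gaussian is its own transform. The scaled Gaussian on the
  right concentrates at 0 as \<open>s\<close> grows, while the weight on the left increases to 1.
\<close>

lemma gaussian_weighted_inverse_fourier:
  assumes f: "f \<in> Cc" and s: "s > 0"
  shows "(LINT t|lborel. of_real (exp (- (t / s)\<^sup>2 / 2)) * inverse_fourier f t) =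
    (LINT u|lborel. of_real (std_normal_density u) * f (u / (2 * pi * s)))" (is "?L = ?R")
proof -
  note [measurable] = Cc_measurable[OF f]
  define c where "c = 2 * pi * s"
  have c: "c > 0" using s by (simp add: c_def)
  have scale: "(LINT t|lborel. h t) = of_real s * (LINT z|lborel. h (s * z))" for h :: "real \<Rightarrow> complex"
    using lborel_integral_real_affine[of s h 0] s by (simp add: scaleR_conv_of_real)
  define F where "F x z = f x * (of_real (std_normal_density z) * exp (\<i> * of_real (c * x * z)))" for x z
  have int: "integrable (lborel \<Otimes>\<^sub>M lborel) (\<lambda>(x, z). F x z)"
  proof (rule lborel_pair.Fubini_integrable)
    show "(\<lambda>(x, z). F x z) \<in> borel_measurable (lborel \<Otimes>\<^sub>M lborel)"
      unfolding F_def by measurable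
    have nF: "norm (F x z) = norm (f x) * std_normal_density z" for x z
      by (simp add: F_def norm_mult norm_exp_eq_Re)
    show "integrable lborel (\<lambda>x. LINT z|lborel. norm (case (x, z) of (x, z) \<Rightarrow> F x z))"
      using Cc_integrable[OF f] by (simp add: nF)
    show "AE x in lborel. integrable lborel (\<lambda>z. case (x, z) of (x, z) \<Rightarrow> F x z)"
    proof (intro AE_I2)
      fix x
      have "integrable lborel (\<lambda>z. norm (f x) * std_normal_density z)" by simp
      then show "integrable lborel (\<lambda>z. case (x, z) of (x, z) \<Rightarrow> F x z)"
        by (rule Bochner_Integration.integrable_bound) (auto simp: F_def norm_mult norm_exp_eq_Re)
    qed
  qed
  have "?L = of_real s * (LINT z|lborel. of_real (exp (- z\<^sup>2 / 2)) * inverse_fourier f (s * z))"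
    using s by (subst scale) simp
  also have "\<dots> = of_real s * (LINT z|lborel. of_real (sqrt (2 * pi)) * (LINT x|lborel. F x z))"
  proof -
    have "of_real (exp (- z\<^sup>2 / 2)) * inverse_fourier f (s * z) =
        of_real (sqrt (2 * pi)) * (LINT x|lborel. F x z)" for z
    proof -
      have "(LINT x|lborel. F x z) =
          (LINT x|lborel. of_real (std_normal_density z) *
            (f x * exp (2 * of_real pi * \<i> * of_real (x * (s * z)))))"
        by (intro Bochner_Integration.integral_cong refl) (simp add: F_def c_def mult_ac)
      also have "\<dots> = of_real (std_normal_density z) * inverse_fourier f (s * z)"
        unfolding inverse_fourier_def by (rule integral_mult_right_zero)
      finally show ?thesis
        by (simp add: std_normal_density_def)
    qed
    then show ?thesis by simp
  qed
  also have "\<dots> = of_real c * ((LINT z|lborel. LINT x|lborel. F x z) / of_real (sqrt (2 * pi)))"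
  proof -
    have "c / sqrt (2 * pi) = s * sqrt (2 * pi)"
      by (simp add: c_def field_simps)
    then have "of_real c / of_real (sqrt (2 * pi)) = (of_real s * of_real (sqrt (2 * pi)) :: complex)"
      by (metis of_real_divide of_real_mult)
    then show ?thesis by (simp add: field_simps)
  qed
  also have "(LINT z|lborel. LINT x|lborel. F x z) = (LINT x|lborel. LINT z|lborel. F x z)"
    by (rule lborel_pair.Fubini_integral[OF int])
  also have "\<dots> = (LINT x|lborel. f x * of_real (exp (- (c * x)\<^sup>2 / 2)))"
    unfolding F_def by (simp only: integral_mult_right_zero char_std_normal_distribution_LINT)
  also have "\<dots> / of_real (sqrt (2 * pi)) = (LINT x|lborel. of_real (std_normal_density (c * x)) * f x)"
    by (subst integral_divide_zero[symmetric], intro Bochner_Integration.integral_cong refl)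
      (simp add: std_normal_density_def)
  also have "of_real c * \<dots> = ?R"
    using lborel_integral_real_affine[of c "\<lambda>u. of_real (std_normal_density u) * f (u / c)" 0] c
    by (simp add: scaleR_conv_of_real c_def[symmetric])
  finally show ?thesis .
qed

lemma gaussian_average_tendsto:
  assumes f: "f \<in> Cc"
  shows "(\<lambda>k. LINT u|lborel. of_real (std_normal_density u) * f (u / (2 * pi * real (Suc k)))) \<longlonglongrightarrow> f 0"
proof -
  obtain M B where M: "M > 0" "B > 0" "\<And>x. \<bar>x\<bar> > M \<Longrightarrow> f x = 0" "\<And>x. norm (f x) \<le> B"
    using Cc_E[OF f] by metis
  have cont: "continuous_on UNIV f" using f by (simp add: Cc_def)
  note [measurable] = Cc_measurable[OF f]
  have "(\<lambda>k. LINT u|lborel. of_real (std_normal_density u) * f (u / (2 * pi * real (Suc k)))) \<longlonglongrightarrow>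
      (LINT u|lborel. of_real (std_normal_density u) * f 0)"
  proof (rule integral_dominated_convergence[where w = "\<lambda>u. std_normal_density u * B"])
    show "AE u in lborel. (\<lambda>k. of_real (std_normal_density u) * f (u / (2 * pi * real (Suc k)))) \<longlonglongrightarrow>
        of_real (std_normal_density u) * f 0"
    proof (intro AE_I2 tendsto_mult tendsto_const continuous_on_tendsto_compose[OF cont])
      fix u :: real
      show "(\<lambda>k. u / (2 * pi * real (Suc k))) \<longlonglongrightarrow> 0"
        by real_asymp
    qed auto
    show "AE u in lborel. norm (of_real (std_normal_density u) * f (u / (2 * pi * real (Suc k)))) \<le>
        std_normal_density u * B" for k
      by (intro AE_I2) (simp add: norm_mult M mult_left_mono)
  qed auto
  also have "(LINT u|lborel. of_real (std_normal_density u) * f 0) = f 0"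
    by simp
  finally show ?thesis .
qed

text \<open>
  The transform of \<open>self_correlation g\<close> is \<open>|inverse_fourier g|\<^sup>2\<close>. Its integral against the Gaussian
  weights of width \<open>k + 1\<close> increases to the full integral by monotone convergence and,
  computed on the other side, tends to \<open>self_correlation g 0 = \<integral> |g|\<^sup>2\<close>. This also gives integrability.
\<close>

theorem plancherel_Cc:
  assumes g: "g \<in> Cc"
  shows "has_bochner_integral lborel (\<lambda>t. (norm (inverse_fourier g t))\<^sup>2)
    (LINT x|lborel. (norm (g x))\<^sup>2)"
proof -
  define I where "I = (LINT x|lborel. (norm (g x))\<^sup>2)"
  define P where "P t = (norm (inverse_fourier g t))\<^sup>2" for t
  define w where "w k t = exp (- (t / real (Suc k))\<^sup>2 / 2)" for k :: nat and t :: real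
  note [measurable] = Cc_measurable[OF g]
  have [measurable]: "P \<in> borel_measurable borel"
    unfolding P_def inverse_fourier_def by measurable
  have P_le: "P t \<le> (LINT x|lborel. norm (g x))\<^sup>2" for t
  proof -
    have "norm (inverse_fourier g t) \<le>
        (LINT x|lborel. norm (g x * exp (2 * of_real pi * \<i> * of_real (x * t))))"
      unfolding inverse_fourier_def by (rule integral_norm_bound)
    also have "\<dots> = (LINT x|lborel. norm (g x))"
      by (simp add: norm_mult norm_exp_eq_Re)
    finally show ?thesis unfolding P_def by (intro power_mono) auto
  qed
  have int: "integrable lborel (\<lambda>t. w k t * P t)" for k
  proof -
    have "integrable lborel (\<lambda>t. std_normal_density (0 + 1 / real (Suc k) * t) *
        (sqrt (2 * pi) * (LINT x|lborel. norm (g x))\<^sup>2))"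
      by (intro integrable_mult_left lborel_integrable_real_affine) auto
    also have "(\<lambda>t. std_normal_density (0 + 1 / real (Suc k) * t) *
        (sqrt (2 * pi) * (LINT x|lborel. norm (g x))\<^sup>2)) =
        (\<lambda>t. w k t * (LINT x|lborel. norm (g x))\<^sup>2)"
      by (simp add: w_def std_normal_density_def)
    finally show ?thesis
    proof (rule Bochner_Integration.integrable_bound)
      show "AE t in lborel. norm (w k t * P t) \<le> norm (w k t * (LINT x|lborel. norm (g x))\<^sup>2)"
        using P_le by (intro AE_I2) (simp add: abs_mult mult_left_mono w_def P_def)
      show "(\<lambda>t. w k t * P t) \<in> borel_measurable lborel"
        unfolding w_def by measurable
    qed
  qed
  have eq: "complex_of_real (LINT t|lborel. w k t * P t) =
      (LINT u|lborel. of_real (std_normal_density u) * self_correlation g (u / (2 * pi * real (Suc k))))" for k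
  proof -
    have "complex_of_real (LINT t|lborel. w k t * P t) =
        (LINT t|lborel. of_real (w k t) * inverse_fourier (self_correlation g) t)"
      by (simp add: inverse_fourier_self_correlation[OF g] P_def flip: integral_complex_of_real)
    then show ?thesis
      unfolding w_def
      by (simp only: gaussian_weighted_inverse_fourier[OF self_correlation_in_Cc[OF g]]
          of_nat_0_less_iff zero_less_Suc)
  qed
  have "(\<lambda>k. complex_of_real (LINT t|lborel. w k t * P t)) \<longlonglongrightarrow> self_correlation g 0"
    unfolding eq by (rule gaussian_average_tendsto[OF self_correlation_in_Cc[OF g]])
  then have lim: "(\<lambda>k. LINT t|lborel. w k t * P t) \<longlonglongrightarrow> I"
    unfolding self_correlation_0 I_def[symmetric] by (simp only: tendsto_of_real_iff)
  have mono: "AE t in lborel. mono (\<lambda>k. w k t * P t)"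
  proof (intro AE_I2 monoI mult_right_mono)
    fix t :: real and i j :: nat assume "i \<le> j"
    then have "\<bar>t / real (Suc j)\<bar> \<le> \<bar>t / real (Suc i)\<bar>"
      by (simp add: frac_le)
    then show "w i t \<le> w j t"
      unfolding w_def by (simp add: abs_le_square_iff del: abs_divide)
  qed (simp add: P_def)
  have ptw: "AE t in lborel. (\<lambda>k. w k t * P t) \<longlonglongrightarrow> P t"
  proof (intro AE_I2)
    fix t
    have "(\<lambda>k. w k t * P t) \<longlonglongrightarrow> 1 * P t"
    proof (intro tendsto_mult tendsto_const)
      have "(\<lambda>k. t / real (Suc k)) \<longlonglongrightarrow> 0"
        by real_asymp
      then have "(\<lambda>k. w k t) \<longlonglongrightarrow> exp (- (0\<^sup>2) / 2)"
        unfolding w_def by (intro tendsto_intros) auto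
      then show "(\<lambda>k. w k t) \<longlonglongrightarrow> 1" by simp
    qed
    then show "(\<lambda>k. w k t * P t) \<longlonglongrightarrow> P t" by simp
  qed
  have "has_bochner_integral lborel P I"
    using integrable_monotone_convergence[OF int mono ptw lim]
      integral_monotone_convergence[OF int mono ptw lim]
    by (simp add: has_bochner_integral_iff)
  then show ?thesis unfolding P_def I_def .
qed

section \<open>Absolute continuity\<close>

definition tent :: "real \<Rightarrow> real \<Rightarrow> real" where
  "tent s x = max 0 (1 - \<bar>x\<bar> / s)"

lemma tent_bounds: "s > 0 \<Longrightarrow> 0 \<le> tent s x" "s > 0 \<Longrightarrow> tent s x \<le> 1"
  by (auto simp: tent_def)

lemma tent_eq_0: "s > 0 \<Longrightarrow> \<bar>x\<bar> > s \<Longrightarrow> tent s x = 0"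
  by (auto simp: tent_def max_def field_simps)

lemma continuous_tent: "s > 0 \<Longrightarrow> continuous_on A (tent s)"
  unfolding tent_def by (intro continuous_intros) auto

lemma integrable_tent: "s > 0 \<Longrightarrow> integrable lborel (tent s)"
  by (rule integrable_bounded_support[of _ s 1])
    (auto simp: tent_eq_0 tent_bounds intro!: borel_measurable_continuous_onI continuous_tent)

lemma integral_tent_ge:
  assumes s: "s > 0"
  shows "s / 2 \<le> (LINT x|lborel. tent s x)"
proof -
  have "s / 2 = (LINT x|lborel. 1 / 2 * indicator {- s / 2..s / 2} x)"
    using s by simp
  also have "\<dots> \<le> (LINT x|lborel. tent s x)"
  proof (rule integral_mono)
    show "integrable lborel (\<lambda>x. 1 / 2 * indicator {- s / 2..s / 2} x :: real)"
      by (intro integrable_mult_right integrable_real_indicator) (auto simp: emeasure_lborel_Icc_eq)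
    show "1 / 2 * indicator {- s / 2..s / 2} x \<le> tent s x" for x
      using s by (auto simp: indicator_def tent_def max_def field_simps)
  qed (rule integrable_tent[OF s])
  finally show ?thesis .
qed

text \<open>
  The test function is a tent of half-width \<open>s\<close>, modulated so that its transform is centred at the
  midpoint \<open>t0\<close> of the interval. The choice of \<open>s\<close> keeps the phase
  \<open>2 * pi * x * (t - t0)\<close> within \<open>pi / 3\<close> for \<open>\<bar>x\<bar> \<le> s\<close> and \<open>t\<close> in the interval, so the cosine is at
  least \<open>1 / 2\<close> there and the transform is at least half the integral \<open>A\<close> of the tent. As
  \<open>\<integral> |g|\<^sup>2 \<le> A\<close>, this gives \<open>\<nu> {a..b} \<le> 4 / A \<le> 8 / s = 24 * (b - a)\<close>.
\<close>

lemma interval_measure_bound: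
  assumes isometry: "\<And>g. g \<in> Cc \<Longrightarrow>
      has_bochner_integral \<nu> (\<lambda>t. (norm (inverse_fourier g t))\<^sup>2) (LINT x|lborel. (norm (g x))\<^sup>2)"
    and sets: "sets \<nu> = sets borel" and fin: "emeasure \<nu> {a..b} < \<infinity>" and ab: "a < b"
  shows "emeasure \<nu> {a..b} \<le> ennreal (24 * (b - a))"
proof -
  define s where "s = 1 / (3 * (b - a))"
  define t0 where "t0 = (a + b) / 2"
  define g where "g x = of_real (tent s x) * exp (- (2 * of_real pi * \<i> * of_real (x * t0)))" for x
  define A where "A = (LINT x|lborel. tent s x)"
  have s: "s > 0" using ab by (simp add: s_def)
  have A: "A \<ge> s / 2" "A > 0"
    using integral_tent_ge[OF s] s by (auto simp: A_def)
  have norm_g: "norm (g x) = tent s x" for x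
    using tent_bounds(1)[OF s, of x] by (simp add: g_def norm_mult norm_exp_eq_Re)
  have g: "g \<in> Cc"
  proof (rule Cc_I)
    show "continuous_on UNIV g"
      unfolding g_def by (intro continuous_intros continuous_tent s)
    show "g x = 0" if "\<bar>x\<bar> > s" for x
      using that s by (simp add: g_def tent_eq_0)
  qed
  have lower: "A / 2 \<le> norm (inverse_fourier g t)" if t: "t \<in> {a..b}" for t
  proof -
    have tt: "\<bar>t - t0\<bar> \<le> (b - a) / 2"
      using t unfolding t0_def abs_le_iff by (auto simp: field_simps)
    have int: "integrable lborel (\<lambda>x. g x * exp (2 * of_real pi * \<i> * of_real (x * t)))"
    proof (rule Bochner_Integration.integrable_bound[OF Cc_integrable[OF g]])
      show "(\<lambda>x. g x * exp (2 * of_real pi * \<i> * of_real (x * t))) \<in> borel_measurable lborel"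
        using Cc_measurable[OF g] by measurable
    qed (simp add: norm_mult norm_exp_eq_Re)
    have Re: "Re (g x * exp (2 * of_real pi * \<i> * of_real (x * t))) =
        tent s x * cos (2 * pi * x * (t - t0))" for x
    proof -
      have "g x * exp (2 * of_real pi * \<i> * of_real (x * t)) =
          of_real (tent s x) * exp (\<i> * of_real (2 * pi * x * (t - t0)))"
        by (simp add: g_def mult.assoc algebra_simps flip: exp_add)
      then show ?thesis by (simp add: Re_exp)
    qed
    have "A / 2 = (LINT x|lborel. tent s x / 2)"
      by (simp add: A_def)
    also have "\<dots> \<le> (LINT x|lborel. Re (g x * exp (2 * of_real pi * \<i> * of_real (x * t))))"
    proof (rule integral_mono)
      show "integrable lborel (\<lambda>x. tent s x / 2)"
        using integrable_tent[OF s] by simp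
      show "integrable lborel (\<lambda>x. Re (g x * exp (2 * of_real pi * \<i> * of_real (x * t))))"
        using int by (rule integrable_Re)
      fix x
      show "tent s x / 2 \<le> Re (g x * exp (2 * of_real pi * \<i> * of_real (x * t)))"
      proof (cases "\<bar>x\<bar> > s")
        case True
        then show ?thesis unfolding Re using s by (simp add: tent_eq_0)
      next
        case False
        have "\<bar>2 * pi * x * (t - t0)\<bar> = 2 * pi * (\<bar>x\<bar> * \<bar>t - t0\<bar>)"
          by (simp add: abs_mult)
        also have "\<dots> \<le> 2 * pi * (s * ((b - a) / 2))"
          using False tt s by (intro mult_left_mono mult_mono) auto
        also have "\<dots> = pi / 3"
          using ab by (simp add: s_def field_simps)
        finally have "cos (pi / 3) \<le> cos \<bar>2 * pi * x * (t - t0)\<bar>"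
          by (intro cos_monotone_0_pi_le) auto
        then have "1 / 2 \<le> cos (2 * pi * x * (t - t0))"
          by (simp only: cos_60 cos_abs_real)
        then have "tent s x * (1 / 2) \<le> tent s x * cos (2 * pi * x * (t - t0))"
          using tent_bounds(1)[OF s] by (intro mult_left_mono)
        then show ?thesis unfolding Re by simp
      qed
    qed
    also have "\<dots> = Re (inverse_fourier g t)"
      unfolding inverse_fourier_def by (rule integral_Re[OF int])
    also have "\<dots> \<le> norm (inverse_fourier g t)"
      by (rule complex_Re_le_cmod)
    finally show ?thesis .
  qed
  have int\<nu>: "integrable \<nu> (\<lambda>t. (norm (inverse_fourier g t))\<^sup>2)"
    and eq: "(LINT t|\<nu>. (norm (inverse_fourier g t))\<^sup>2) = (LINT x|lborel. (norm (g x))\<^sup>2)"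
    using isometry[OF g] by (auto simp: has_bochner_integral_iff)
  have ab_sets: "{a..b} \<in> sets \<nu>" by (simp add: sets)
  have "(A / 2)\<^sup>2 * measure \<nu> {a..b} = (LINT t|\<nu>. (A / 2)\<^sup>2 * indicator {a..b} t)"
    using ab_sets sets.sets_into_space[OF ab_sets] by (simp add: Int_absorb2)
  also have "\<dots> \<le> (LINT t|\<nu>. (norm (inverse_fourier g t))\<^sup>2)"
  proof (rule integral_mono)
    show "integrable \<nu> (\<lambda>t. (A / 2)\<^sup>2 * indicator {a..b} t :: real)"
      using fin ab_sets by (intro integrable_mult_right integrable_real_indicator) auto
    show "(A / 2)\<^sup>2 * indicator {a..b} t \<le> (norm (inverse_fourier g t))\<^sup>2" for t
      using lower[of t] A by (cases "t \<in> {a..b}") (auto intro: power_mono)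
  qed (rule int\<nu>)
  also have "\<dots> = (LINT x|lborel. (tent s x)\<^sup>2)"
    by (simp add: eq norm_g)
  also have "\<dots> \<le> A"
    unfolding A_def
  proof (rule integral_mono)
    show le: "(tent s x)\<^sup>2 \<le> tent s x" for x
      using tent_bounds[OF s, of x] by (simp add: power2_eq_square mult_left_le)
    show "integrable lborel (\<lambda>x. (tent s x)\<^sup>2)"
    proof (rule Bochner_Integration.integrable_bound[OF integrable_tent[OF s]])
      show "(\<lambda>x. (tent s x)\<^sup>2) \<in> borel_measurable lborel"
        using integrable_tent[OF s] by measurable
      show "AE x in lborel. norm ((tent s x)\<^sup>2) \<le> norm (tent s x)"
        using le tent_bounds(1)[OF s] by auto
    qed
  qed (rule integrable_tent[OF s])
  finally have "A * (A * measure \<nu> {a..b}) \<le> A * 4"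
    by (simp add: power2_eq_square)
  then have "A * measure \<nu> {a..b} \<le> 4"
    using A(2) by (simp only: mult_le_cancel_left_pos)
  moreover have "s / 2 * measure \<nu> {a..b} \<le> A * measure \<nu> {a..b}"
    using A by (intro mult_right_mono) auto
  ultimately have "s / 2 * measure \<nu> {a..b} \<le> 4" by linarith
  then have "measure \<nu> {a..b} \<le> 24 * (b - a)"
    using ab by (simp add: s_def field_simps)
  then show ?thesis
    using fin by (simp add: emeasure_eq_ennreal_measure ennreal_leI)
qed

text \<open>
  A bounded null set is covered by countably many intervals with disjoint interiors and small total
  length. The interval bound adds up over finitely many of them because
  their lengths do, and continuity from below extends it to the whole cover.
\<close>

lemma absolutely_continuous_if_interval_bound:
  fixes \<nu> :: "real measure"
  assumes sets: "sets \<nu> = sets borel" and K: "K \<ge> 0"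
    and bound: "\<And>a b. a < b \<Longrightarrow> emeasure \<nu> {a..b} \<le> ennreal (K * (b - a))"
  shows "absolutely_continuous lborel \<nu>"
  unfolding absolutely_continuous_def
proof
  fix N :: "real set" assume N: "N \<in> null_sets lborel"
  then have N_borel: "N \<in> sets borel" by (simp add: null_sets_def)
  have le: "emeasure \<nu> (N \<inter> {- real (Suc k)..real (Suc k)}) \<le> ennreal e" if e: "e > 0" for k e
  proof -
    let ?c = "real (Suc k)" and ?d = "e / (K + 1)"
    let ?S = "N \<inter> cbox (- ?c) ?c"
    have d: "?d > 0" using e K by simp
    have "?S \<in> null_sets lborel" using N by (intro null_set_Int2) auto
    then have S: "?S \<in> null_sets lebesgue" by (rule null_sets_completionI)
    then have lmS: "?S \<in> lmeasurable" by (rule fmeasurableI_null_sets)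
    obtain \<D> where count: "countable \<D>"
      and cb: "\<And>J. J \<in> \<D> \<Longrightarrow> J \<subseteq> cbox (- ?c) ?c \<and> J \<noteq> {} \<and> (\<exists>u v. J = cbox u v)"
      and disj: "pairwise (\<lambda>A B. interior A \<inter> interior B = {}) \<D>"
      and nonempty: "\<And>J. \<lbrakk>J \<in> \<D>; box (- ?c) ?c \<noteq> {}\<rbrakk> \<Longrightarrow> interior J \<noteq> {}"
      and cover: "?S \<subseteq> \<Union>\<D>" and lm: "\<Union>\<D> \<in> lmeasurable"
      and small: "measure lebesgue (\<Union>\<D>) \<le> measure lebesgue ?S + ?d"
      by (rule measurable_outer_intervals_bounded[OF lmS Int_lower2 d]) (rule that; assumption)
    have small': "measure lebesgue (\<Union>\<D>) \<le> ?d"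
      using small S by (simp add: measure_eq_0_null_sets)
    have D_borel: "J \<in> sets borel" if "J \<in> \<D>" for J
      using cb[OF that] by auto
    have single: "emeasure \<nu> J \<le> ennreal (K * measure lebesgue J)" if J: "J \<in> \<D>" for J
    proof -
      obtain u v where uv: "J = {u..v}" using cb[OF J] by auto
      have "u < v" using nonempty[OF J] uv by (auto simp: interior_atLeastAtMost_real)
      then show ?thesis using bound[of u v] by (simp add: uv)
    qed
    have finite_le: "emeasure \<nu> (\<Union>\<F>) \<le> ennreal e" if F: "finite \<F>" "\<F> \<subseteq> \<D>" for \<F>
    proof -
      have "\<F> division_of \<Union>\<F>"
      proof (rule division_ofI)
        show "interior J \<inter> interior J' = {}" if "J \<in> \<F>" "J' \<in> \<F>" "J \<noteq> J'" for J J'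
          using that F pairwiseD[OF disj] by (meson subsetD)
        show "J \<noteq> {}" "\<exists>u v. J = cbox u v" if "J \<in> \<F>" for J
          using that F(2) cb[of J] by auto
      qed (use F(1) in auto)
      then have content: "measure lebesgue (\<Union>\<F>) = sum (measure lebesgue) \<F>"
        by (rule content_division[symmetric])
      have meas: "J \<in> sets \<nu>" if "J \<in> \<F>" for J
        using that F(2) D_borel by (auto simp: sets)
      have "emeasure \<nu> (\<Union>\<F>) \<le> (\<Sum>J\<in>\<F>. emeasure \<nu> J)"
        using emeasure_subadditive_finite[of \<F> "\<lambda>J. J" \<nu>] F meas by auto
      also have "\<dots> \<le> (\<Sum>J\<in>\<F>. ennreal (K * measure lebesgue J))"
        using F by (intro sum_mono single) auto
      also have "\<dots> = ennreal (K * measure lebesgue (\<Union>\<F>))"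
        using K by (subst sum_ennreal) (auto simp: content sum_distrib_left)
      also have "\<dots> \<le> ennreal e"
      proof (rule ennreal_leI)
        have "measure lebesgue (\<Union>\<F>) \<le> measure lebesgue (\<Union>\<D>)"
        proof (intro measure_mono_fmeasurable lm)
          have "\<Union>\<F> \<in> sets lborel"
            using F meas by (intro sets.finite_Union) (auto simp: sets)
          then show "\<Union>\<F> \<in> sets lebesgue" by (rule sets_completionI_sets)
        qed (use F in auto)
        then have "K * measure lebesgue (\<Union>\<F>) \<le> K * ?d"
          using small' K by (intro mult_left_mono) auto
        also have "\<dots> \<le> e" using e K by (simp add: field_simps)
        finally show "K * measure lebesgue (\<Union>\<F>) \<le> e" .
      qed
      finally show ?thesis .
    qed
    show ?thesis
    proof (cases "\<D> = {}")
      case True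
      then have "N \<inter> {- ?c..?c} = {}" using cover by simp
      then show ?thesis by (metis emeasure_empty zero_le)
    next
      case False
      define U where "U n = \<Union>(from_nat_into \<D> ` {..<n})" for n
      have in_D: "from_nat_into \<D> n \<in> \<D>" for n
        using False by (rule from_nat_into)
      have UN: "(\<Union>n. U n) = \<Union>\<D>"
      proof -
        have "(\<Union>n. U n) = \<Union>(range (from_nat_into \<D>))"
          unfolding U_def by blast
        then show ?thesis by (simp add: range_from_nat_into[OF False count])
      qed
      have meas: "U n \<in> sets \<nu>" for n
        unfolding U_def sets using D_borel[OF in_D] by (intro sets.finite_Union) auto
      have "emeasure \<nu> (N \<inter> {- ?c..?c}) \<le> emeasure \<nu> (\<Union>n. U n)"
      proof (rule emeasure_mono)
        show "N \<inter> {- ?c..?c} \<subseteq> (\<Union>n. U n)" using cover by (simp add: UN)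
        show "(\<Union>n. U n) \<in> sets \<nu>" using meas by (intro sets.countable_UN) auto
      qed
      also have "\<dots> = (SUP n. emeasure \<nu> (U n))"
      proof (rule SUP_emeasure_incseq[symmetric])
        show "incseq U"
          unfolding U_def incseq_def by (intro allI impI Union_mono image_mono) auto
      qed (use meas in auto)
      also have "\<dots> \<le> ennreal e"
        unfolding U_def using in_D by (intro SUP_least finite_le) auto
      finally show ?thesis .
    qed
  qed
  have "emeasure \<nu> (N \<inter> {- real (Suc k)..real (Suc k)}) \<le> 0" for k
  proof (rule ennreal_le_epsilon)
    show "emeasure \<nu> (N \<inter> {- real (Suc k)..real (Suc k)}) \<le> 0 + ennreal e" if "e > 0" for e
      unfolding add_0 using that by (rule le)
  qed
  then have null: "N \<inter> {- real (Suc k)..real (Suc k)} \<in> null_sets \<nu>" for k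
    using N_borel by (auto simp: null_sets_def sets)
  have N_eq: "N = (\<Union>k. N \<inter> {- real (Suc k)..real (Suc k)})"
  proof -
    have "\<exists>k. x \<in> {- real (Suc k)..real (Suc k)}" for x
    proof -
      obtain k where "\<bar>x\<bar> < real k" using reals_Archimedean2 by blast
      then show ?thesis by (intro exI[of _ k]) auto
    qed
    then show ?thesis by blast
  qed
  show "N \<in> null_sets \<nu>"
    by (subst N_eq) (intro null_sets_UN null)
qed

lemma has_fourier_transform_dirac_iff:
  assumes \<gamma>: "\<And>f. f \<in> Cc \<Longrightarrow> \<gamma> f = f 0"
  shows "has_fourier_transform \<gamma> \<nu> \<longleftrightarrow> sets \<nu> = sets borel \<and>
     (\<forall>K. compact K \<longrightarrow> emeasure \<nu> K < \<infinity>) \<and>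
     (\<forall>g\<in>Cc. has_bochner_integral \<nu> (\<lambda>t. (norm (inverse_fourier g t))\<^sup>2)
       (LINT x|lborel. (norm (g x))\<^sup>2))"
  unfolding has_fourier_transform_def has_bochner_integral_iff
  by (auto simp: \<gamma> self_correlation_in_Cc self_correlation_0)

theorem corollary4p2:
  fixes n :: nat and \<epsilon> :: "nat \<Rightarrow> complex"
  assumes "n > 2"
    and "\<And>m. m \<ge> 1 \<Longrightarrow> \<epsilon> m \<in> {root_of_unity n ^ j | j. j \<le> n - 1}"
    and "\<And>k. rs_poly n k 1 = (\<Sum>m=1..n^k. monom (\<epsilon> m) m)"
  shows "purely_absolutely_continuous_diffraction \<epsilon>"
  unfolding purely_absolutely_continuous_diffraction_def
proof (intro allI impI conjI)
  fix \<gamma> assume acc: "autocorrelation \<epsilon> \<gamma>"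
  have n: "n > 1" using assms(1) by simp
  have e1: "norm (\<epsilon> m) = 1" if "m \<ge> 1" for m
    using assms(2)[OF that] by (auto simp: norm_power norm_root_of_unity)
  have \<gamma>: "\<gamma> f = f 0" if "f \<in> Cc" for f
    using autocorrelation_eq_dirac[OF n e1 rs_sequence_lowest_digit[OF n assms(3)] acc that] .
  note ft_iff = has_fourier_transform_dirac_iff[of \<gamma>, OF \<gamma>]
  show "\<exists>\<nu>. has_fourier_transform \<gamma> \<nu>"
    by (rule exI[of _ lborel])
      (auto simp: ft_iff plancherel_Cc emeasure_bounded_finite[unfolded infinity_ennreal_def]
        compact_imp_bounded)
  fix \<nu> assume ft: "has_fourier_transform \<gamma> \<nu>"
  show "absolutely_continuous lborel \<nu>"
  proof (rule absolutely_continuous_if_interval_bound)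
    show "emeasure \<nu> {a..b} \<le> ennreal (24 * (b - a))" if "a < b" for a b
      using ft that by (intro interval_measure_bound) (auto simp: ft_iff)
  qed (use ft in \<open>auto simp: has_fourier_transform_def\<close>)
qed

end
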